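(* (a) For any $s,t\in\mathbb{C}$ with $s\ne t$, one has $\mathcal{T}_s\neq\mathcal{T}_t$. (b) For any $t\in\mathbb{C}$, the algebra isomorphism $\Phi_t:(\mathcal{B}_t[\xi,z],\mathcal{T}_t)\to(\mathcal{A}[\xi,z],\mathcal{T}_0)$ is also a homeomorphism of topological spaces. Consequently, the topological spaces $(\mathcal{B}_t[\xi,z],\mathcal{T}_t)$ $(t\in\mathbb{C})$ are all homeomorphic.
   Context: Let $n\ge1$, let $\xi=(\xi_1,\dots,\xi_n)$ and $z=(z_1,\dots,z_n)$ be $2n$ commuting free variables, $\partial_i=\partial/\partial z_i$, $\delta_i=\partial/\partial \xi_i$. $\mathcal{A}[\xi,z]$ is the vector space $\mathbb{C}[\xi,z]$ with the usual polynomial multiplication. For $t\in\mathbb{C}$, $\mathcal{B}_t[\xi,z]$ is the vector space $\mathbb{C}[\xi,z]$ with the product $f\ast_t g:=\mu\big(e^{-t\Omega}(f\otimes g)\big)$, where $\Omega=\sum_{i=1}^n(\partial_i\otimes\delta_i+\delta_i\otimes\partial_i)$ and $\mu(f\otimes g)=fg$ is the usual multiplication; so $\mathcal{B}_0[\xi,z]=\mathcal{A}[\xi,z]$. Let $\Lambda:=\sum_{i=1}^n\delta_i\partial_i$ and $\Phi_t:=e^{t\Lambda}=\sum_{m\ge0}\frac{t^m\Lambda^m}{m!}$, which is an algebra isomorphism $\mathcal{B}_t[\xi,z]\to\mathcal{A}[\xi,z]$. For $t\in\mathbb{C}$ and $m\ge0$, let $U_{t,m}$ be the subspace of $\mathbb{C}[\xi,z]$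 spanned by the elements $\xi^\alpha\ast_t z^\beta$ with $\alpha,\beta\in\mathbb{N}^n$ and $|\alpha+\beta|\ge m$ (where $|\gamma|$ is the sum of the entries of $\gamma$). $\mathcal{T}_t$ (the $\ell$-adic topology on $\mathbb{C}[\xi,z]$ induced by $\mathcal{B}_t[\xi,z]$) is the topology on $\mathbb{C}[\xi,z]$ whose open sets are generated by the $U_{t,m}$ $(m\in\mathbb{N})$ and their translates by elements of $\mathbb{C}[\xi,z]$. *)

theory Defs
  imports "HOL-Analysis.Analysis" "HOL-Library.Poly_Mapping"
begin

section \<open>Free complex vector spaces\<close>

text \<open>
  The type \<open>'k \<Rightarrow>\<^sub>0 complex\<close> of finitely supported functions is the complex vector space with
  basis \<open>single k 1\<close>, where \<open>k\<close> ranges over \<open>'k\<close>.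
\<close>

definition pscale :: "complex \<Rightarrow> ('k \<Rightarrow>\<^sub>0 complex) \<Rightarrow> ('k \<Rightarrow>\<^sub>0 complex)" where
  "pscale c = Poly_Mapping.map ((*) c)"

lemma lookup_pscale [simp]: "Poly_Mapping.lookup (pscale c p) k = c * Poly_Mapping.lookup p k"
  by (simp add: pscale_def Poly_Mapping.map.rep_eq when_def)

global_interpretation pvs: vector_space "pscale :: complex \<Rightarrow> ('k \<Rightarrow>\<^sub>0 complex) \<Rightarrow> _"
  by unfold_locales (auto intro!: poly_mapping_eqI simp: lookup_add algebra_simps)

definition lin_ext :: "('k \<Rightarrow> ('l \<Rightarrow>\<^sub>0 complex)) \<Rightarrow> ('k \<Rightarrow>\<^sub>0 complex) \<Rightarrow> ('l \<Rightarrow>\<^sub>0 complex)" where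
  "lin_ext f u = (\<Sum>k\<in>Poly_Mapping.keys u. pscale (Poly_Mapping.lookup u k) (f k))"

text \<open>
  \<open>exp_op c D\<close> is the operator \<open>e\<^bsup>cD\<^esup>\<close>, for a locally nilpotent operator \<open>D\<close>: for each \<open>u\<close> the
  sum then has only finitely many nonzero terms. (\<open>Sum_any\<close> would return \<open>0\<close> otherwise; the
  lemmas \<open>finite_exp_Lambda\<close> and \<open>finite_exp_Omega\<close> exclude this in the two cases used.)
\<close>

definition exp_op :: "complex \<Rightarrow> (('k \<Rightarrow>\<^sub>0 complex) \<Rightarrow> ('k \<Rightarrow>\<^sub>0 complex))
    \<Rightarrow> ('k \<Rightarrow>\<^sub>0 complex) \<Rightarrow> ('k \<Rightarrow>\<^sub>0 complex)" where
  "exp_op c D u = Sum_any (\<lambda>m. pscale (c ^ m / fact m) ((D ^^ m) u))"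

section \<open>Polynomials in \<open>\<xi>\<close> and \<open>z\<close>\<close>

text \<open>
  The \<open>n\<close> indices are the elements of a finite type \<open>'n\<close>, so \<open>n = CARD('n) \<ge> 1\<close>. Monomials are
  exponent vectors on the variables \<open>'n + 'n\<close>, where \<open>Inl i\<close> stands for \<open>\<xi>\<^sub>i\<close> and \<open>Inr i\<close> for
  \<open>z\<^sub>i\<close>; the product of the ring \<open>'n xzpoly\<close> is the usual multiplication of polynomials.
\<close>

type_synonym 'n xzmon = "('n + 'n) \<Rightarrow>\<^sub>0 nat"
type_synonym 'n xzpoly = "'n xzmon \<Rightarrow>\<^sub>0 complex"

definition pvar :: "'n + 'n \<Rightarrow> 'n xzpoly" where
  "pvar v = Poly_Mapping.single (Poly_Mapping.single v 1) 1"

definition xi_pow :: "('n::finite \<Rightarrow> nat) \<Rightarrow> 'n xzpoly" where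
  "xi_pow \<alpha> = (\<Prod>i\<in>UNIV. pvar (Inl i) ^ \<alpha> i)"

definition z_pow :: "('n::finite \<Rightarrow> nat) \<Rightarrow> 'n xzpoly" where
  "z_pow \<beta> = (\<Prod>i\<in>UNIV. pvar (Inr i) ^ \<beta> i)"

definition pderivative :: "'n + 'n \<Rightarrow> 'n xzpoly \<Rightarrow> 'n xzpoly" where
  "pderivative v =
    lin_ext (\<lambda>a. Poly_Mapping.single (a - Poly_Mapping.single v 1) (of_nat (Poly_Mapping.lookup a v)))"

abbreviation d_z :: "'n \<Rightarrow> 'n xzpoly \<Rightarrow> 'n xzpoly" where
  "d_z i \<equiv> pderivative (Inr i)"

abbreviation d_xi :: "'n \<Rightarrow> 'n xzpoly \<Rightarrow> 'n xzpoly" where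
  "d_xi i \<equiv> pderivative (Inl i)"

definition Lambda :: "'n::finite xzpoly \<Rightarrow> 'n xzpoly" where
  "Lambda f = (\<Sum>i\<in>UNIV. d_xi i (d_z i f))"

definition Phi :: "complex \<Rightarrow> 'n::finite xzpoly \<Rightarrow> 'n xzpoly" where
  "Phi t = exp_op t Lambda"

section \<open>The product \<open>\<ast>\<^sub>t\<close>\<close>

text \<open>
  The tensor square of the polynomial space is realised as the space with basis the pairs
  \<open>(a, b)\<close> of monomials, the pair standing for \<open>a \<otimes> b\<close>.
\<close>

type_synonym 'n xztensor = "('n xzmon \<times> 'n xzmon) \<Rightarrow>\<^sub>0 complex"

definition tensor :: "'n xzpoly \<Rightarrow> 'n xzpoly \<Rightarrow> 'n xztensor" where
  "tensor f g = (\<Sum>a\<in>Poly_Mapping.keys f. \<Sum>b\<in>Poly_Mapping.keys g. Poly_Mapping.single (a, b) (Poly_Mapping.lookup f a * Poly_Mapping.lookup g b))"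

definition tensor_map :: "('n xzpoly \<Rightarrow> 'n xzpoly) \<Rightarrow> ('n xzpoly \<Rightarrow> 'n xzpoly)
    \<Rightarrow> 'n xztensor \<Rightarrow> 'n xztensor" where
  "tensor_map D E =
    lin_ext (\<lambda>(a, b). tensor (D (Poly_Mapping.single a 1)) (E (Poly_Mapping.single b 1)))"

definition mu :: "'n xztensor \<Rightarrow> 'n xzpoly" where
  "mu = lin_ext (\<lambda>(a, b). Poly_Mapping.single a 1 * Poly_Mapping.single b 1)"

definition Omega :: "'n::finite xztensor \<Rightarrow> 'n xztensor" where
  "Omega u = (\<Sum>i\<in>UNIV. tensor_map (d_z i) (d_xi i) u + tensor_map (d_xi i) (d_z i) u)"

definition star :: "complex \<Rightarrow> 'n::finite xzpoly \<Rightarrow> 'n xzpoly \<Rightarrow> 'n xzpoly" where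
  "star t f g = mu (exp_op (- t) Omega (tensor f g))"

text \<open>
  An isomorphism between two unital algebra structures on the polynomial space that have the
  given products and the common unit \<open>1\<close>.
\<close>

definition algebra_iso :: "('n xzpoly \<Rightarrow> 'n xzpoly \<Rightarrow> 'n xzpoly)
    \<Rightarrow> ('n xzpoly \<Rightarrow> 'n xzpoly \<Rightarrow> 'n xzpoly) \<Rightarrow> ('n xzpoly \<Rightarrow> 'n xzpoly) \<Rightarrow> bool" where
  "algebra_iso prod1 prod2 \<phi> \<longleftrightarrow>
    Vector_Spaces.linear pscale pscale \<phi> \<and> bij \<phi> \<and> \<phi> 1 = 1 \<and>
    (\<forall>f g. \<phi> (prod1 f g) = prod2 (\<phi> f) (\<phi> g))"

section \<open>The topologies\<close>

definition U_space :: "complex \<Rightarrow> nat \<Rightarrow> 'n::finite xzpoly set" where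
  "U_space t m = pvs.span {star t (xi_pow \<alpha>) (z_pow \<beta>) | \<alpha> \<beta>. (\<Sum>i\<in>UNIV. \<alpha> i + \<beta> i) \<ge> m}"

definition ell_topology :: "complex \<Rightarrow> 'n::finite xzpoly topology" where
  "ell_topology t = topology_generated_by {(+) f ` U_space t m | f m. True}"

section \<open>Sanity checks\<close>

lemma lin_ext_superset:
  assumes "finite A" "Poly_Mapping.keys u \<subseteq> A"
  shows "lin_ext f u = (\<Sum>k\<in>A. pscale (Poly_Mapping.lookup u k) (f k))"
  unfolding lin_ext_def using assms
  by (intro sum.mono_neutral_left) (auto simp: in_keys_iff)

lemma linear_lin_ext: "Vector_Spaces.linear pscale pscale (lin_ext f)"
proof (unfold_locales)
  fix u v :: "'a \<Rightarrow>\<^sub>0 complex" and c :: complex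
  let ?A = "Poly_Mapping.keys u \<union> Poly_Mapping.keys v"
  have "Poly_Mapping.keys (u + v) \<subseteq> ?A" by (rule keys_add)
  then have "lin_ext f (u + v) = (\<Sum>k\<in>?A. pscale (Poly_Mapping.lookup (u + v) k) (f k))"
    by (intro lin_ext_superset) auto
  also have "\<dots> = (\<Sum>k\<in>?A. pscale (Poly_Mapping.lookup u k) (f k)) + (\<Sum>k\<in>?A. pscale (Poly_Mapping.lookup v k) (f k))"
    by (simp add: lookup_add pvs.scale_left_distrib sum.distrib)
  also have "\<dots> = lin_ext f u + lin_ext f v"
    using lin_ext_superset[of ?A u f] lin_ext_superset[of ?A v f] by simp
  finally show "lin_ext f (u + v) = lin_ext f u + lin_ext f v" .
  have "Poly_Mapping.keys (pscale c u) \<subseteq> Poly_Mapping.keys u" by (auto simp: in_keys_iff)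
  then have "lin_ext f (pscale c u) = (\<Sum>k\<in>Poly_Mapping.keys u. pscale (Poly_Mapping.lookup (pscale c u) k) (f k))"
    by (intro lin_ext_superset) auto
  then show "lin_ext f (pscale c u) = pscale c (lin_ext f u)"
    by (simp add: lin_ext_def pvs.scale_sum_right)
qed

lemma lin_ext_single [simp]: "lin_ext f (Poly_Mapping.single k c) = pscale c (f k)"
  by (subst lin_ext_superset[of "{k}"]) (auto simp: lookup_single)

lemma pderivative_single:
  "pderivative v (Poly_Mapping.single a c) =
    Poly_Mapping.single (a - Poly_Mapping.single v 1) (c * of_nat (Poly_Mapping.lookup a v))"
  unfolding pderivative_def
  by (auto intro!: poly_mapping_eqI simp: lookup_single when_def)

lemma pderivative_pvar: "pderivative v (pvar w) = (if v = w then 1 else 0)"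
  by (simp add: pvar_def pderivative_single lookup_single)

lemma tensor_superset:
  assumes "finite A" "finite B" "Poly_Mapping.keys f \<subseteq> A" "Poly_Mapping.keys g \<subseteq> B"
  shows "tensor f g = (\<Sum>a\<in>A. \<Sum>b\<in>B. Poly_Mapping.single (a, b) (Poly_Mapping.lookup f a * Poly_Mapping.lookup g b))"
proof -
  have "(\<Sum>b\<in>Poly_Mapping.keys g. Poly_Mapping.single (a, b) (Poly_Mapping.lookup f a * Poly_Mapping.lookup g b))
      = (\<Sum>b\<in>B. Poly_Mapping.single (a, b) (Poly_Mapping.lookup f a * Poly_Mapping.lookup g b))" for a
    using assms by (intro sum.mono_neutral_left) (auto simp: in_keys_iff)
  then show ?thesis
    unfolding tensor_def using assms
    by (simp, intro sum.mono_neutral_left) (auto simp: in_keys_iff)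
qed

lemma lookup_tensor:
  "Poly_Mapping.lookup (tensor f g) (a, b) = Poly_Mapping.lookup f a * Poly_Mapping.lookup g b"
proof -
  let ?A = "insert a (Poly_Mapping.keys f)" and ?B = "insert b (Poly_Mapping.keys g)"
  have "Poly_Mapping.lookup (tensor f g) (a, b) = (\<Sum>x\<in>?A. \<Sum>y\<in>?B.
      if x = a then if y = b then Poly_Mapping.lookup f x * Poly_Mapping.lookup g y else 0 else 0)"
    by (subst tensor_superset[of ?A ?B]) (auto simp: lookup_sum lookup_single when_def intro!: sum.cong)
  also have "\<dots> = (\<Sum>x\<in>?A. if x = a then \<Sum>y\<in>?B. if y = b then Poly_Mapping.lookup f x * Poly_Mapping.lookup g y else 0 else 0)"
    by (intro sum.cong) auto
  also have "\<dots> = Poly_Mapping.lookup f a * Poly_Mapping.lookup g b"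
    by (simp only: sum.delta finite_insert finite_keys) auto
  finally show ?thesis .
qed

lemma lin_ext_sum: "lin_ext f (sum u A) = (\<Sum>x\<in>A. lin_ext f (u x))"
  using linear_lin_ext[of f] by (simp add: Vector_Spaces.linear_iff_module_hom module_hom.sum)

lemma poly_mapping_expand: "f = (\<Sum>a\<in>Poly_Mapping.keys f. Poly_Mapping.single a (Poly_Mapping.lookup f a))"
  by (rule poly_mapping_eqI)
     (auto simp: lookup_sum lookup_single when_def sum.delta in_keys_iff)

lemma mu_tensor: "mu (tensor f g) = f * g"
proof -
  have "mu (tensor f g) = (\<Sum>a\<in>Poly_Mapping.keys f. \<Sum>b\<in>Poly_Mapping.keys g.
      pscale (Poly_Mapping.lookup f a * Poly_Mapping.lookup g b) (Poly_Mapping.single (a + b) 1))"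
    by (simp add: mu_def tensor_def lin_ext_sum mult_single)
  also have "\<dots> = (\<Sum>a\<in>Poly_Mapping.keys f. \<Sum>b\<in>Poly_Mapping.keys g.
      Poly_Mapping.single a (Poly_Mapping.lookup f a) * Poly_Mapping.single b (Poly_Mapping.lookup g b))"
    by (intro sum.cong refl poly_mapping_eqI) (simp add: mult_single lookup_single when_def)
  also have "\<dots> = f * g"
    by (simp add: sum_product[symmetric] poly_mapping_expand[symmetric])
  finally show ?thesis .
qed

lemma linear_expand:
  assumes "Vector_Spaces.linear pscale pscale D"
  shows "D = lin_ext (\<lambda>k. D (Poly_Mapping.single k 1))"
proof
  fix u :: "'a \<Rightarrow>\<^sub>0 complex"
  interpret D: Vector_Spaces.linear pscale pscale D by fact
  have "D u = D (\<Sum>k\<in>Poly_Mapping.keys u. pscale (Poly_Mapping.lookup u k) (Poly_Mapping.single k 1))"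
  proof -
    have *: "pscale c (Poly_Mapping.single k 1) = Poly_Mapping.single k c" for c and k :: 'a
      by (rule poly_mapping_eqI) (simp add: lookup_single when_def)
    show ?thesis by (simp add: * poly_mapping_expand[symmetric])
  qed
  then show "D u = lin_ext (\<lambda>k. D (Poly_Mapping.single k 1)) u"
    by (simp add: D.sum D.scale lin_ext_def)
qed

lemma tensor_map_tensor:
  assumes "Vector_Spaces.linear pscale pscale D" "Vector_Spaces.linear pscale pscale E"
  shows "tensor_map D E (tensor f g) = tensor (D f) (E g)"
proof -
  interpret D: Vector_Spaces.linear pscale pscale D by fact
  interpret E: Vector_Spaces.linear pscale pscale E by fact
  have lk: "Poly_Mapping.lookup (D f) a
      = (\<Sum>k\<in>Poly_Mapping.keys f. Poly_Mapping.lookup f k * Poly_Mapping.lookup (D (Poly_Mapping.single k 1)) a)" for a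
    by (subst linear_expand[OF assms(1)]) (simp add: lin_ext_def lookup_sum)
  have lk': "Poly_Mapping.lookup (E g) a
      = (\<Sum>k\<in>Poly_Mapping.keys g. Poly_Mapping.lookup g k * Poly_Mapping.lookup (E (Poly_Mapping.single k 1)) a)" for a
    by (subst linear_expand[OF assms(2)]) (simp add: lin_ext_def lookup_sum)
  show ?thesis
    by (rule poly_mapping_eqI)
       (auto simp: tensor_map_def tensor_def[of f g] lin_ext_sum lookup_sum lookup_tensor
          lk lk' sum_product algebra_simps)
qed

lemma finite_nilpotent:
  assumes lin: "Vector_Spaces.linear pscale pscale D"
    and dec: "\<And>k l. l \<in> Poly_Mapping.keys (D (Poly_Mapping.single k 1)) \<Longrightarrow> d l < (d k :: nat)"
  shows "finite {m. pscale (c m) ((D ^^ m) u) \<noteq> 0}"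
proof -
  interpret D: Vector_Spaces.linear pscale pscale D by fact
  have nil: "(D ^^ N) u = 0" if "\<forall>k\<in>Poly_Mapping.keys u. d k < N" for N u
    using that
  proof (induction N arbitrary: u)
    case 0
    then show ?case by simp
  next
    case (Suc N)
    have "\<forall>l\<in>Poly_Mapping.keys (D u). d l < N"
    proof
      fix l assume "l \<in> Poly_Mapping.keys (D u)"
      then have "Poly_Mapping.lookup (lin_ext (\<lambda>k. D (Poly_Mapping.single k 1)) u) l \<noteq> 0"
        using linear_expand[OF lin] by (simp add: in_keys_iff)
      then obtain k where k: "k \<in> Poly_Mapping.keys u"
          "Poly_Mapping.lookup (D (Poly_Mapping.single k 1)) l \<noteq> 0"
        unfolding lin_ext_def lookup_sum by (auto elim!: sum.not_neutral_contains_not_neutral)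
      then show "d l < N"
        using dec[of l k] Suc.prems by (fastforce simp: in_keys_iff)
    qed
    then show ?case using Suc.IH by (simp add: funpow_swap1)
  qed
  obtain N where N: "\<forall>k\<in>Poly_Mapping.keys u. d k < N"
    using finite_nat_set_iff_bounded[of "d ` Poly_Mapping.keys u"] by auto
  have "{m. pscale (c m) ((D ^^ m) u) \<noteq> 0} \<subseteq> {..<N}"
  proof
    fix m assume m: "m \<in> {m. pscale (c m) ((D ^^ m) u) \<noteq> 0}"
    show "m \<in> {..<N}"
    proof (rule ccontr)
      assume "m \<notin> {..<N}"
      then have "(D ^^ m) u = 0" using N by (intro nil) auto
      then show False using m by simp
    qed
  qed
  then show ?thesis by (rule finite_subset) simp
qed

lemma linear_pderivative: "Vector_Spaces.linear pscale pscale (pderivative v)"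
  unfolding pderivative_def by (rule linear_lin_ext)

lemma linear_Lambda: "Vector_Spaces.linear pscale pscale Lambda"
proof -
  note pl = linear_pderivative[unfolded Vector_Spaces.linear_iff_module_hom]
  show ?thesis
    unfolding Vector_Spaces.linear_iff_module_hom module_hom_iff Lambda_def
    using pvs.module_axioms
    by (simp add: module_hom.add[OF pl] module_hom.scale[OF pl] sum.distrib pvs.scale_sum_right)
qed

lemma linear_Omega: "Vector_Spaces.linear pscale pscale Omega"
proof -
  have pl: "module_hom pscale pscale (tensor_map D E)" for D E
    unfolding tensor_map_def using linear_lin_ext
    by (simp add: Vector_Spaces.linear_iff_module_hom)
  show ?thesis
    unfolding Vector_Spaces.linear_iff_module_hom module_hom_iff Omega_def
    using pvs.module_axioms
    by (simp add: module_hom.add[OF pl] module_hom.scale[OF pl] sum.distrib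
        pvs.scale_sum_right pvs.scale_right_distrib algebra_simps)
qed

definition mdeg :: "'n::finite xzmon \<Rightarrow> nat" where
  "mdeg a = (\<Sum>v\<in>UNIV. Poly_Mapping.lookup a v)"

lemma mdeg_pderivative:
  assumes "l \<in> Poly_Mapping.keys (pderivative v f)"
  shows "\<exists>k\<in>Poly_Mapping.keys f. mdeg l < mdeg k"
proof -
  from assms obtain k where k: "k \<in> Poly_Mapping.keys f"
    "Poly_Mapping.lookup k v \<noteq> 0" "l = k - Poly_Mapping.single v 1"
    by (auto simp: pderivative_def lin_ext_def in_keys_iff lookup_sum lookup_single when_def
        elim!: sum.not_neutral_contains_not_neutral split: if_splits)
  have "mdeg l < mdeg k"
    unfolding mdeg_def k(3)
    by (rule sum_strict_mono_ex1) (use k(2) in \<open>auto simp: lookup_minus intro!: exI[of _ v]\<close>)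
  with k(1) show ?thesis by blast
qed

lemma finite_exp_Lambda: "finite {m. pscale (t ^ m / fact m) ((Lambda ^^ m) u) \<noteq> 0}"
proof (rule finite_nilpotent[OF linear_Lambda, where d = mdeg])
  fix k l :: "'a xzmon"
  assume "l \<in> Poly_Mapping.keys (Lambda (Poly_Mapping.single k 1))"
  then obtain i where "l \<in> Poly_Mapping.keys (d_xi i (d_z i (Poly_Mapping.single k 1)))"
    by (auto simp: Lambda_def in_keys_iff lookup_sum elim!: sum.not_neutral_contains_not_neutral)
  then show "mdeg l < mdeg k"
    by (fastforce dest!: mdeg_pderivative)
qed

lemma finite_exp_Omega: "finite {m. pscale (t ^ m / fact m) ((Omega ^^ m) u) \<noteq> 0}"
proof (rule finite_nilpotent[OF linear_Omega, where d = "\<lambda>(a, b). mdeg a + mdeg b"])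
  fix k l :: "'a xzmon \<times> 'a xzmon"
  obtain a b a' b' where kl: "k = (a, b)" "l = (a', b')" by fastforce
  assume "l \<in> Poly_Mapping.keys (Omega (Poly_Mapping.single k 1))"
  then obtain v w where
    "Poly_Mapping.lookup (tensor (pderivative v (Poly_Mapping.single a 1))
       (pderivative w (Poly_Mapping.single b 1))) (a', b') \<noteq> 0"
    by (auto simp: Omega_def tensor_map_def kl in_keys_iff lookup_sum lookup_add
        elim!: sum.not_neutral_contains_not_neutral) (metis add.right_neutral)
  then have "a' \<in> Poly_Mapping.keys (pderivative v (Poly_Mapping.single a 1))"
    "b' \<in> Poly_Mapping.keys (pderivative w (Poly_Mapping.single b 1))"
    by (auto simp: lookup_tensor in_keys_iff)
  then show "(case l of (a, b) \<Rightarrow> mdeg a + mdeg b) < (case k of (a, b) \<Rightarrow> mdeg a + mdeg b)"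
    by (fastforce simp: kl dest!: mdeg_pderivative)
qed

lemma exp_op_0: "exp_op 0 D u = u"
proof -
  have "pscale (0 ^ m / fact m) ((D ^^ m) u) = (if m = 0 then u else 0)" for m
    by (cases m) auto
  then show ?thesis by (simp add: exp_op_def)
qed

lemma star_0: "star 0 f g = f * g"
  by (simp add: star_def exp_op_0 mu_tensor)

lemma topspace_ell_topology: "topspace (ell_topology t) = UNIV"
proof -
  have "f \<in> (+) f ` U_space t 0" for f :: "'a xzpoly"
    by (rule image_eqI[of _ _ 0]) (auto simp: U_space_def pvs.span_zero)
  then show ?thesis unfolding ell_topology_def topology_generated_by_topspace by blast
qed

end

theory Submission
  imports Defs
begin

text \<open>
  The multiplication \<open>\<mu>\<close> carries \<open>\<Lambda> \<otimes> 1 + 1 \<otimes> \<Lambda> + \<Omega>\<close> to \<open>\<Lambda>\<close>: this is the Leibniz rule for the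
  second-order operator \<open>\<Lambda> = \<Sum>\<^sub>i \<delta>\<^sub>i \<partial>\<^sub>i\<close>, whose cross terms are exactly \<open>\<mu> \<circ> \<Omega>\<close>
  (\<open>Lambda_mu\<close>). The three operators \<open>\<Lambda> \<otimes> 1\<close>, \<open>1 \<otimes> \<Lambda>\<close> and \<open>\<Omega>\<close> commute, since they are built
  from partial derivatives, so their exponentials multiply like numbers
  (\<open>exp_op_commuting\<close>). Hence \<open>\<Phi>\<^sub>t \<circ> \<mu> \<circ> e\<^bsup>-t\<Omega>\<^esup> = \<mu> \<circ> (\<Phi>\<^sub>t \<otimes> \<Phi>\<^sub>t)\<close>, which says that \<open>\<Phi>\<^sub>t\<close> is
  multiplicative from \<open>\<ast>\<^sub>t\<close> to the usual product (\<open>Phi_star\<close>); it is bijective because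
  \<open>\<Phi>\<^sub>s \<circ> \<Phi>\<^sub>t = \<Phi>\<^bsub>s+t\<^esub>\<close>.

  As \<open>\<Lambda>\<close> kills every \<open>\<xi>\<^sup>\<alpha>\<close> and every \<open>z\<^sup>\<beta>\<close>, the map \<open>\<Phi>\<^sub>t\<close> sends \<open>\<xi>\<^sup>\<alpha> \<ast>\<^sub>t z\<^sup>\<beta>\<close> to \<open>\<xi>\<^sup>\<alpha> z\<^sup>\<beta>\<close>. So it maps
  the subspace \<open>U\<close> of index \<open>(t, m)\<close> onto the one of index \<open>(0, m)\<close>, for each \<open>m\<close>
  (\<open>Phi_image_U_space\<close>). Being linear, it also matches the translates, and is therefore a
  homeomorphism.

  For the distinctness of the topologies, the subspaces of parameter \<open>t\<close> form a
  neighbourhood base at \<open>0\<close> because they decrease with \<open>m\<close>. If the topologies for \<open>s\<close> and \<open>t\<close>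
  agree, the subspace of index \<open>(t, m)\<close> lies, for some \<open>m\<close>, in that of index \<open>(s, 1)\<close>; applying
  \<open>\<Phi>\<^sub>s\<close>, every \<open>\<Phi>\<^bsub>s-t\<^esub> f\<close> with \<open>f\<close> of order at least \<open>m\<close> has constant term \<open>0\<close>. But the constant
  term of \<open>\<Phi>\<^sub>c (\<xi>\<^sub>i\<^sup>m z\<^sub>i\<^sup>m)\<close> is \<open>c\<^sup>m m!\<close> (\<open>constant_term_Phi\<close>), so \<open>s = t\<close>.
\<close>

section \<open>Exponentials of commuting operators\<close>

abbreviation plinear :: "(('k \<Rightarrow>\<^sub>0 complex) \<Rightarrow> ('l \<Rightarrow>\<^sub>0 complex)) \<Rightarrow> bool" where
  "plinear \<equiv> Vector_Spaces.linear pscale pscale"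

type_synonym 'k endo = "('k \<Rightarrow>\<^sub>0 complex) \<Rightarrow> ('k \<Rightarrow>\<^sub>0 complex)"

lemma plinearI:
  assumes "\<And>u v. D (u + v) = D u + D v" "\<And>c u. D (pscale c u) = pscale c (D u)"
  shows "plinear D"
  using assms by unfold_locales

lemma plinear_add: "plinear D \<Longrightarrow> D (u + v) = D u + D v"
  by (simp add: Vector_Spaces.linear_iff_module_hom module_hom.add)

lemma plinear_scale: "plinear D \<Longrightarrow> D (pscale c u) = pscale c (D u)"
  by (simp add: Vector_Spaces.linear_iff_module_hom module_hom.scale)

lemma plinear_zero: "plinear D \<Longrightarrow> D 0 = 0"
  by (simp add: Vector_Spaces.linear_iff_module_hom module_hom.zero)

lemma plinear_sum: "plinear D \<Longrightarrow> D (sum u A) = (\<Sum>x\<in>A. D (u x))"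
  by (simp add: Vector_Spaces.linear_iff_module_hom module_hom.sum)

lemma plinear_funpow: "plinear (D :: 'k endo) \<Longrightarrow> plinear (D ^^ m)"
  by (induction m) (auto intro!: plinearI simp: plinear_add plinear_scale)

lemma plinear_combination:
  "plinear D \<Longrightarrow> plinear E \<Longrightarrow> plinear (\<lambda>v. pscale c (D v) + pscale d (E v))"
  by (intro plinearI) (simp_all add: plinear_add plinear_scale algebra_simps
      pvs.scale_right_distrib mult.commute)

lemma plinear_plus: "plinear D \<Longrightarrow> plinear E \<Longrightarrow> plinear (\<lambda>v. D v + E v)"
  using plinear_combination[of D E 1 1] by simp

lemma funpow_zero_mono:
  fixes D :: "'k endo"
  assumes "plinear D" "(D ^^ N) u = 0" "N \<le> m"
  shows "(D ^^ m) u = 0"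
proof -
  have "(D ^^ m) u = (D ^^ (m - N)) ((D ^^ N) u)"
    using assms(3) by (metis comp_apply funpow_add le_add_diff_inverse2)
  then show ?thesis using assms by (simp add: plinear_zero plinear_funpow)
qed

lemma funpow_intertwine:
  fixes D :: "'k \<Rightarrow> 'k" and E :: "'l \<Rightarrow> 'l"
  assumes "\<And>v. L (D v) = E (L v)"
  shows "L ((D ^^ m) v) = (E ^^ m) (L v)"
  by (induction m) (simp_all add: assms)

text \<open>
  Pointwise nilpotency is enough to turn an exponential, applied to the given vector, into a
  finite sum. On tensors it is easily inherited by \<open>\<Lambda> \<otimes> 1\<close> and \<open>1 \<otimes> \<Lambda>\<close>, without any
  bookkeeping of degrees.
\<close>

definition nilpotent_at :: "'k endo \<Rightarrow> ('k \<Rightarrow>\<^sub>0 complex) \<Rightarrow> bool" where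
  "nilpotent_at D u \<longleftrightarrow> (\<exists>N. (D ^^ N) u = 0)"

lemma nilpotent_at_two:
  assumes "plinear D" "plinear E" "nilpotent_at D u" "nilpotent_at E v"
  obtains N where "(D ^^ N) u = 0" "(E ^^ N) v = 0"
proof -
  obtain M N where "(D ^^ M) u = 0" "(E ^^ N) v = 0"
    using assms(3,4) by (auto simp: nilpotent_at_def)
  then have "(D ^^ max M N) u = 0" "(E ^^ max M N) v = 0"
    using assms(1,2) by (auto intro: funpow_zero_mono)
  then show ?thesis by (rule that)
qed

lemma exp_op_finite_sum:
  fixes D :: "'k endo"
  assumes "plinear D" "(D ^^ N) u = 0"
  shows "exp_op c D u = (\<Sum>m<N. pscale (c ^ m / fact m) ((D ^^ m) u))"
proof -
  have *: "(D ^^ m) u = 0" if "\<not> m < N" for m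
    using that assms by (auto intro: funpow_zero_mono)
  show ?thesis
    unfolding exp_op_def
    by (rule Sum_any.expand_superset) (use * in force)+
qed

lemma exp_op_zero_vector:
  fixes D :: "'k endo"
  assumes "plinear D" "D u = 0"
  shows "exp_op c D u = u"
  using exp_op_finite_sum[of D 1 u c] assms by simp

text \<open>
  \<open>L\<close> carries the partial sums for \<open>D\<close> to those for \<open>E\<close> term by term. With \<open>L\<close> taken to be \<open>\<mu>\<close>, to
  \<open>f \<mapsto> f \<otimes> g\<close>, or to a power of an operator commuting with \<open>D = E\<close>, this moves exponentials
  past these maps.
\<close>

lemma exp_op_intertwine:
  assumes "plinear L" "plinear D" "plinear E" and comm: "\<And>v. L (D v) = E (L v)"
    and "nilpotent_at D u"
  shows "L (exp_op c D u) = exp_op c E (L u)"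
proof -
  obtain N where N: "(D ^^ N) u = 0" using assms(5) by (auto simp: nilpotent_at_def)
  then have "(E ^^ N) (L u) = 0"
    using funpow_intertwine[where L = L and D = D and E = E and m = N and v = u] comm assms(1) by (simp add: plinear_zero)
  then show ?thesis
    using N assms(1-3)
    by (simp add: exp_op_finite_sum plinear_sum plinear_scale funpow_intertwine[where L = L and D = D and E = E, OF comm])
qed

lemma plinear_exp_op:
  fixes D :: "'k endo"
  assumes "plinear D" "\<And>u. nilpotent_at D u"
  shows "plinear (exp_op c D)"
proof (rule plinearI)
  fix u v :: "'k \<Rightarrow>\<^sub>0 complex" and a :: complex
  obtain N where N: "(D ^^ N) u = 0" "(D ^^ N) v = 0"
    using nilpotent_at_two assms by blast
  have "(D ^^ N) (u + v) = 0" "(D ^^ N) (pscale a u) = 0"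
    using N by (simp_all add: plinear_add[OF plinear_funpow] plinear_scale[OF plinear_funpow] assms)
  then show "exp_op c D (u + v) = exp_op c D u + exp_op c D v"
    "exp_op c D (pscale a u) = pscale a (exp_op c D u)"
    using N assms(1)
    by (simp_all add: exp_op_finite_sum[where N = N] plinear_add[OF plinear_funpow]
        plinear_scale[OF plinear_funpow] pvs.scale_right_distrib sum.distrib
        pvs.scale_sum_right mult.commute)
qed

lemma funpow_scaled:
  fixes D :: "'k endo"
  assumes "plinear D"
  shows "((\<lambda>v. pscale c (D v)) ^^ m) u = pscale (c ^ m) ((D ^^ m) u)"
  by (induction m) (simp_all add: plinear_scale[OF assms])

lemma exp_op_scaled: "plinear D \<Longrightarrow> exp_op c D u = exp_op 1 (\<lambda>v. pscale c (D v)) u"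
  by (simp add: exp_op_def funpow_scaled)

text \<open>
  The binomial theorem, with divided powers so that the induction step has no binomial
  coefficients: for \<open>P i j = D\<^sup>i E\<^sup>j u / (i! j!)\<close> the operators act by \<open>D (P i j) = (i + 1) P (i + 1) j\<close>
  and \<open>E (P i j) = (j + 1) P i (j + 1)\<close>.
\<close>

lemma binomial_operators:
  fixes D E :: "'k endo"
  assumes D: "plinear D" and E: "plinear E" and comm: "\<And>v. D (E v) = E (D v)"
  shows "pscale (1 / fact m) (((\<lambda>v. D v + E v) ^^ m) u)
    = (\<Sum>i\<le>m. pscale (1 / (fact i * fact (m - i))) ((D ^^ i) ((E ^^ (m - i)) u)))"
proof (induction m)
  case 0
  then show ?case by simp
next
  case (Suc m)
  define P where "P i j = pscale (1 / (fact i * fact j)) ((D ^^ i) ((E ^^ j) u))" for i j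
  have DP: "D (P i j) = pscale (of_nat (Suc i)) (P (Suc i) j)" for i j
    by (simp add: P_def plinear_scale[OF D] field_simps del: of_nat_Suc)
  have "E ((D ^^ i) v) = (D ^^ i) (E v)" for i v
    by (rule funpow_intertwine) (simp add: comm)
  then have EP: "E (P i j) = pscale (of_nat (Suc j)) (P i (Suc j))" for i j
    by (simp add: P_def plinear_scale[OF E] field_simps del: of_nat_Suc)
  \<comment> \<open>Weight each term on the antidiagonal \<open>i + j = m + 1\<close> by \<open>m + 1 = i + j\<close>; the part with weight
     \<open>i\<close> comes from \<open>D\<close>, the part with weight \<open>j\<close> from \<open>E\<close>.\<close>
  have "pscale (of_nat (Suc m)) (\<Sum>i\<le>Suc m. P i (Suc m - i))
      = (\<Sum>i\<le>Suc m. pscale (of_nat i) (P i (Suc m - i)))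
        + (\<Sum>i\<le>Suc m. pscale (of_nat (Suc m - i)) (P i (Suc m - i)))"
    unfolding pvs.scale_sum_right sum.distrib[symmetric]
    by (intro sum.cong refl) (simp add: pvs.scale_left_distrib[symmetric] of_nat_diff)
  also have "(\<Sum>i\<le>Suc m. pscale (of_nat i) (P i (Suc m - i)))
      = (\<Sum>i\<le>m. D (P i (m - i)))"
    by (subst sum.atMost_Suc_shift) (simp add: DP)
  also have "(\<Sum>i\<le>Suc m. pscale (of_nat (Suc m - i)) (P i (Suc m - i)))
      = (\<Sum>i\<le>m. E (P i (m - i)))"
    by (simp add: EP Suc_diff_le del: of_nat_Suc of_nat_diff)
  also have "(\<Sum>i\<le>m. D (P i (m - i))) + (\<Sum>i\<le>m. E (P i (m - i)))
     = pscale (1 / fact m) (((\<lambda>v. D v + E v) ^^ Suc m) u)"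
    using Suc.IH by (simp add: P_def plinear_sum[OF D, symmetric] plinear_sum[OF E, symmetric]
       pvs.scale_right_distrib plinear_scale[OF D, symmetric] plinear_scale[OF E, symmetric])
  finally have "pscale (1 / of_nat (Suc m)) (pscale (of_nat (Suc m)) (\<Sum>i\<le>Suc m. P i (Suc m - i)))
     = pscale (1 / of_nat (Suc m)) (pscale (1 / fact m) (((\<lambda>v. D v + E v) ^^ Suc m) u))"
    by (rule arg_cong)
  then show ?case
    by (simp add: P_def field_simps del: of_nat_Suc sum.atMost_Suc funpow.simps)
qed

text \<open>
  Suppose that \<open>D\<^sup>N\<close> and \<open>E\<^sup>N\<close> kill \<open>u\<close>. In \<open>(D + E)\<^bsup>2N\<^esup> u\<close> each term \<open>D\<^sup>i E\<^sup>j u\<close> has \<open>i \<ge> N\<close> or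
  \<open>j \<ge> N\<close>, and so vanishes. The product of the two exponentials sums \<open>D\<^sup>i E\<^sup>j u / (i! j!)\<close> over the
  square \<open>i, j < N\<close>, the exponential of the sum over the triangle \<open>i + j < 2N\<close>; the triangle
  contains the square, and the additional terms are \<open>0\<close>.
\<close>

lemma exp_op_sum:
  fixes D E :: "'k endo"
  assumes D: "plinear D" and E: "plinear E" and comm: "\<And>v. D (E v) = E (D v)"
    and nil: "nilpotent_at D u" "nilpotent_at E u"
  shows "nilpotent_at (\<lambda>v. D v + E v) u"
    and "exp_op 1 D (exp_op 1 E u) = exp_op 1 (\<lambda>v. D v + E v) u"
proof -
  let ?S = "\<lambda>v. D v + E v"
  define P where "P i j = pscale (1 / (fact i * fact j)) ((D ^^ i) ((E ^^ j) u))" for i j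
  obtain N where N: "(D ^^ N) u = 0" "(E ^^ N) u = 0"
    using nilpotent_at_two D E nil by blast
  have ED: "(E ^^ j) ((D ^^ i) v) = (D ^^ i) ((E ^^ j) v)" for i j v
    by (intro funpow_intertwine[symmetric] funpow_intertwine comm)
  have D0: "(D ^^ i) ((E ^^ j) u) = 0" if "N \<le> i" for i j
    using funpow_zero_mono[OF D N(1) that] ED[of j i u]
    by (simp add: plinear_zero plinear_funpow E)
  have P0: "P i j = 0" if "N \<le> i \<or> N \<le> j" for i j
    using that D0 funpow_zero_mono[OF E N(2)]
    by (auto simp: P_def plinear_zero plinear_funpow D)
  have S: "pscale (1 / fact m) ((?S ^^ m) u) = (\<Sum>i\<le>m. P i (m - i))" for m
    unfolding P_def using binomial_operators[OF D E comm] .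
  have "P i (2 * N - i) = 0" for i
    by (rule P0) auto
  then have "pscale (1 / fact (2 * N)) ((?S ^^ (2 * N)) u) = 0"
    unfolding S by simp
  then have SN: "(?S ^^ (2 * N)) u = 0" by (simp)
  then show "nilpotent_at ?S u" by (auto simp: nilpotent_at_def)
  have "exp_op 1 D (exp_op 1 E u) = (\<Sum>i<N. \<Sum>j<N. P i j)"
  proof -
    have e: "exp_op 1 E u = (\<Sum>j<N. pscale (1 / fact j) ((E ^^ j) u))"
      using exp_op_finite_sum[OF E N(2), of 1] by simp
    have "(D ^^ N) (exp_op 1 E u) = 0"
      unfolding e by (simp add: plinear_sum plinear_scale plinear_funpow D D0)
    then have "exp_op 1 D (exp_op 1 E u)
        = (\<Sum>i<N. pscale (1 / fact i) ((D ^^ i) (exp_op 1 E u)))"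
      using exp_op_finite_sum[OF D, of N "exp_op 1 E u" 1] by simp
    then show ?thesis
      unfolding e P_def
      by (simp add: plinear_sum plinear_scale plinear_funpow D pvs.scale_sum_right)
  qed
  also have "\<dots> = (\<Sum>(i, j) \<in> {..<N} \<times> {..<N}. P i j)"
    by (simp add: sum.cartesian_product)
  also have "\<dots> = (\<Sum>(i, j) \<in> {(i, j). i + j < 2 * N}. P i j)"
  proof (rule sum.mono_neutral_left)
    show "finite {(i, j). i + j < 2 * N}"
      by (rule finite_subset[of _ "{..<2 * N} \<times> {..<2 * N}"]) auto
  qed (auto simp: not_less intro!: P0)
  also have "\<dots> = (\<Sum>m<2 * N. \<Sum>i\<le>m. P i (m - i))"
    by (rule sum.triangle_reindex)
  also have "\<dots> = exp_op 1 ?S u"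
    using exp_op_finite_sum[OF plinear_plus[OF D E] SN, of 1] by (simp add: S)
  finally show "exp_op 1 D (exp_op 1 E u) = exp_op 1 ?S u" .
qed

lemma nilpotent_at_scaled:
  assumes "plinear D" "nilpotent_at D u"
  shows "nilpotent_at (\<lambda>v. pscale c (D v)) u"
proof -
  obtain N where "(D ^^ N) u = 0" using assms(2) by (auto simp: nilpotent_at_def)
  then have "((\<lambda>v. pscale c (D v)) ^^ N) u = 0" by (simp add: funpow_scaled[OF assms(1)])
  then show ?thesis by (auto simp: nilpotent_at_def)
qed

text \<open>
  The right-hand side is \<open>e\<^bsup>cD + dE\<^esup>\<close>. Keeping two scalars inside one exponential lets the same
  identity serve for the cancellation of \<open>e\<^bsup>-t\<Omega>\<^esup>\<close>, for the splitting of \<open>e\<^bsup>t(D + E)\<^esup>\<close>, and (with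
  \<open>D = E\<close>) for the group law of \<open>\<Phi>\<^sub>t\<close>.
\<close>

lemma exp_op_commuting:
  assumes D: "plinear D" and E: "plinear E" and comm: "\<And>v. D (E v) = E (D v)"
    and nil: "nilpotent_at D u" "nilpotent_at E u"
  shows "exp_op c D (exp_op d E u) = exp_op 1 (\<lambda>v. pscale c (D v) + pscale d (E v)) u"
proof -
  have l: "plinear (\<lambda>v. pscale c (D v))" "plinear (\<lambda>v. pscale d (E v))"
    using plinear_combination[OF D D, of c 0] plinear_combination[OF E E, of d 0] by simp_all
  show ?thesis
    unfolding exp_op_scaled[OF D, of c] exp_op_scaled[OF E, of d]
    using nil
    by (intro exp_op_sum(2) l nilpotent_at_scaled D E)
       (simp_all add: plinear_scale D E comm mult.commute)
qed

section \<open>Derivations and the tensor square\<close>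

lemma pscale_single [simp]: "pscale c (Poly_Mapping.single k d) = Poly_Mapping.single k (c * d)"
  by (rule poly_mapping_eqI) (simp add: lookup_single when_def)

lemma plinear_eq_on_basis:
  assumes "plinear D" "plinear E"
    and "\<And>k. D (Poly_Mapping.single k 1) = E (Poly_Mapping.single k 1)"
  shows "D u = E u"
  by (subst linear_expand[OF assms(1)], subst linear_expand[OF assms(2)]) (simp add: assms(3))

lemma pderivative_zero [simp]: "pderivative v 0 = 0"
  by (rule plinear_zero[OF linear_pderivative])

lemma pderivative_commute: "pderivative v (pderivative w f) = pderivative w (pderivative v f)"
proof (rule plinear_eq_on_basis[where u = f])
  fix k :: "'a xzmon"
  show "pderivative v (pderivative w (Poly_Mapping.single k 1))
      = pderivative w (pderivative v (Poly_Mapping.single k 1))"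
    by (cases "v = w") (simp_all add: pderivative_single lookup_minus lookup_single
        diff_diff_add add.commute mult.commute)
qed (auto intro!: plinearI simp: plinear_add plinear_scale linear_pderivative)

lemma pscale_eq_mult: "pscale c f = Poly_Mapping.single 0 c * (f :: 'n xzpoly)"
proof -
  let ?e = "\<Sum>a\<in>Poly_Mapping.keys f. Poly_Mapping.single a (Poly_Mapping.lookup f a)"
  have "pscale c ?e = Poly_Mapping.single 0 c * ?e"
    by (simp add: pvs.scale_sum_right sum_distrib_left mult_single)
  then show ?thesis by (simp only: poly_mapping_expand[symmetric])
qed

lemma pscale_mult_left: "pscale c f * g = pscale c (f * g :: 'n xzpoly)"
  and pscale_mult_right: "f * pscale c g = pscale c (f * g :: 'n xzpoly)"
  by (simp_all add: pscale_eq_mult ac_simps)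

text \<open>
  Both sides are bilinear, so monomials suffice. There the exponents on the two sides agree
  except where truncated subtraction interferes, that is when the differentiated variable does
  not occur; the coefficient is then \<open>0\<close>.
\<close>

lemma pderivative_mult:
  "pderivative v (f * g) = pderivative v f * g + f * pderivative v g"
proof -
  have monomials: "pderivative v (Poly_Mapping.single a 1 * Poly_Mapping.single b 1)
      = pderivative v (Poly_Mapping.single a 1) * Poly_Mapping.single b 1
        + Poly_Mapping.single a 1 * pderivative v (Poly_Mapping.single b 1)" for a b
  proof -
    have *: "Poly_Mapping.single (a - Poly_Mapping.single v 1 + b) (of_nat (Poly_Mapping.lookup a v))
      = (Poly_Mapping.single (a + b - Poly_Mapping.single v 1) (of_nat (Poly_Mapping.lookup a v)) :: 'a xzpoly)"
      for a b :: "'a xzmon"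
    proof (cases "Poly_Mapping.lookup a v = 0")
      case False
      then have "a - Poly_Mapping.single v 1 + b = a + b - Poly_Mapping.single v 1"
        by (intro poly_mapping_eqI) (auto simp: lookup_add lookup_minus lookup_single when_def)
      then show ?thesis by simp
    qed simp
    show ?thesis
      using *[of a b] *[of b a]
      by (simp add: pderivative_single mult_single lookup_add single_add ac_simps del: One_nat_def)
  qed
  note lin = linear_pderivative[of v]
  have *: "pderivative v (Poly_Mapping.single a 1 * g)
      = pderivative v (Poly_Mapping.single a 1) * g + Poly_Mapping.single a 1 * pderivative v g" for a
    by (rule plinear_eq_on_basis[where u = g])
       (auto intro!: plinearI simp: plinear_add[OF lin] plinear_scale[OF lin]
          distrib_left pscale_mult_right pvs.scale_right_distrib monomials)
  show ?thesis
    by (rule plinear_eq_on_basis[where u = f])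
       (auto intro!: plinearI simp: plinear_add[OF lin] plinear_scale[OF lin]
          distrib_right pscale_mult_left pvs.scale_right_distrib *)
qed

lemma pderivative_Lambda: "pderivative v (Lambda f) = Lambda (pderivative v f)"
  unfolding Lambda_def
  by (simp add: plinear_sum[OF linear_pderivative] pderivative_commute[of v])

text \<open>
  The mixed terms of the second-order Leibniz rule are those produced by \<open>\<Omega>\<close> on \<open>f \<otimes> g\<close>.
\<close>

lemma Lambda_mult:
  "Lambda (f * g) = Lambda f * g + f * Lambda g
    + (\<Sum>i\<in>UNIV. d_z i f * d_xi i g + d_xi i f * d_z i g)"
  unfolding Lambda_def
  by (simp add: pderivative_mult plinear_add[OF linear_pderivative] sum.distrib
      sum_distrib_left sum_distrib_right algebra_simps)

lemma nilpotent_atI_finite: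
  assumes "finite {m. pscale (1 ^ m / fact m) ((D ^^ m) u) \<noteq> 0}"
  shows "nilpotent_at D u"
proof -
  obtain N where "N \<notin> {m. pscale (1 ^ m / fact m) ((D ^^ m) u) \<noteq> 0}"
    using assms ex_new_if_finite infinite_UNIV_nat by blast
  then show ?thesis by (auto simp: nilpotent_at_def)
qed

lemma nilpotent_at_Lambda: "nilpotent_at Lambda f"
  and nilpotent_at_Omega: "nilpotent_at Omega u"
  by (intro nilpotent_atI_finite finite_exp_Lambda finite_exp_Omega)+

lemma plinear_tensor_left: "plinear (\<lambda>f. tensor f g)"
  and plinear_tensor_right: "plinear (\<lambda>g. tensor f g)"
  by (auto intro!: plinearI poly_mapping_eqI simp: lookup_tensor lookup_add algebra_simps)

lemma plinear_tensor_map: "plinear (tensor_map D E)"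
  unfolding tensor_map_def by (rule linear_lin_ext)

lemma plinear_mu: "plinear mu"
  unfolding mu_def by (rule linear_lin_ext)

text \<open>
  Pure tensors contain the basis of the tensor square. All identities between operators on the
  tensor square below are reduced in this way to identities between derivatives.
\<close>

lemma plinear_eq_on_tensors:
  assumes "plinear D" "plinear E" "\<And>f g. D (tensor f g) = E (tensor f g)"
  shows "D u = E u"
proof (rule plinear_eq_on_basis[OF assms(1,2)])
  fix k :: "'a xzmon \<times> 'a xzmon"
  have "Poly_Mapping.single k 1
      = tensor (Poly_Mapping.single (fst k) 1) (Poly_Mapping.single (snd k) 1)"
    by (rule poly_mapping_eqI) (auto simp: lookup_tensor lookup_single when_def split: prod.splits)
  then show "D (Poly_Mapping.single k 1) = E (Poly_Mapping.single k 1)"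
    using assms(3) by simp
qed

lemma Omega_tensor:
  "Omega (tensor f g) = (\<Sum>i\<in>UNIV. tensor (d_z i f) (d_xi i g) + tensor (d_xi i f) (d_z i g))"
  by (simp add: Omega_def tensor_map_tensor linear_pderivative)

definition Lambda_left :: "'n::finite xztensor \<Rightarrow> 'n xztensor" where
  "Lambda_left = tensor_map Lambda (\<lambda>g. g)"

definition Lambda_right :: "'n::finite xztensor \<Rightarrow> 'n xztensor" where
  "Lambda_right = tensor_map (\<lambda>f. f) Lambda"

lemma Lambda_left_tensor: "Lambda_left (tensor f g) = tensor (Lambda f) g"
  and Lambda_right_tensor: "Lambda_right (tensor f g) = tensor f (Lambda g)"
  unfolding Lambda_left_def Lambda_right_def
  by (rule tensor_map_tensor; intro linear_Lambda plinearI; simp)+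

lemma plinear_Lambda_left: "plinear Lambda_left"
  and plinear_Lambda_right: "plinear Lambda_right"
  unfolding Lambda_left_def Lambda_right_def by (rule plinear_tensor_map)+

lemma plinear_compose:
  "plinear D \<Longrightarrow> plinear E \<Longrightarrow> plinear (\<lambda>u. D (E u))"
  by (auto intro!: plinearI simp: plinear_add plinear_scale)

lemmas tensor_operators_linear = plinear_compose plinear_plus
  plinear_Lambda_left plinear_Lambda_right linear_Omega linear_Lambda plinear_mu

lemma Lambda_left_right_commute: "Lambda_left (Lambda_right u) = Lambda_right (Lambda_left u)"
  by (rule plinear_eq_on_tensors[where u = u])
     (simp_all add: tensor_operators_linear Lambda_left_tensor Lambda_right_tensor)

lemma Lambda_left_Omega_commute: "Lambda_left (Omega u) = Omega (Lambda_left u)"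
  by (rule plinear_eq_on_tensors[where u = u])
     (simp_all add: tensor_operators_linear Lambda_left_tensor Omega_tensor pderivative_Lambda
        plinear_sum[OF plinear_Lambda_left] plinear_add[OF plinear_Lambda_left])

lemma Lambda_right_Omega_commute: "Lambda_right (Omega u) = Omega (Lambda_right u)"
  by (rule plinear_eq_on_tensors[where u = u])
     (simp_all add: tensor_operators_linear Lambda_right_tensor Omega_tensor pderivative_Lambda
        plinear_sum[OF plinear_Lambda_right] plinear_add[OF plinear_Lambda_right])

text \<open>
  The link between the deformed and the usual product: along \<open>\<mu>\<close>, the operator \<open>\<Lambda>\<close> lifts to
  \<open>\<Lambda> \<otimes> 1 + 1 \<otimes> \<Lambda> + \<Omega>\<close>.
\<close>

lemma Lambda_mu: "Lambda (mu u) = mu (Lambda_left u + Lambda_right u + Omega u)"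
  by (rule plinear_eq_on_tensors[where u = u])
     (simp_all add: tensor_operators_linear Lambda_left_tensor Lambda_right_tensor Omega_tensor
        mu_tensor Lambda_mult plinear_sum[OF plinear_mu] plinear_add[OF plinear_mu])

section \<open>The algebra isomorphism\<close>

text \<open>
  With \<open>K = \<Lambda> \<otimes> 1 + 1 \<otimes> \<Lambda>\<close> and \<open>H = K + \<Omega>\<close> the computation is
  \<open>\<Phi>\<^sub>t (\<mu> (e\<^bsup>-t\<Omega>\<^esup> (f \<otimes> g))) = \<mu> (e\<^bsup>tH\<^esup> (e\<^bsup>-t\<Omega>\<^esup> (f \<otimes> g))) = \<mu> (e\<^bsup>tK\<^esup> (f \<otimes> g)) = \<mu> (\<Phi>\<^sub>t f \<otimes> \<Phi>\<^sub>t g)\<close>.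
\<close>

lemma Phi_star: "Phi t (star t f g) = Phi t f * Phi t g"
proof -
  let ?x = "tensor f g"
  let ?K = "\<lambda>u. Lambda_left u + Lambda_right u"
  let ?H = "\<lambda>u. ?K u + Omega u"
  let ?w = "exp_op (- t) Omega ?x"
  note lin = plinear_Lambda_left plinear_Lambda_right linear_Omega
  have linK: "plinear ?K" by (intro plinear_plus lin)
  have linH: "plinear ?H" by (intro plinear_plus lin)
  have KO: "?K (Omega u) = Omega (?K u)" for u
    by (simp add: Lambda_left_Omega_commute Lambda_right_Omega_commute plinear_add[OF linear_Omega])
  have HO: "?H (Omega u) = Omega (?H u)" for u
    using KO[of u] by (simp add: plinear_add[OF linear_Omega])

  have powl: "(Lambda_left ^^ m) ?x = tensor ((Lambda ^^ m) f) g" for m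
    using funpow_intertwine[where L = "\<lambda>f. tensor f g" and D = Lambda and E = Lambda_left and m = m and v = f]
    by (simp add: Lambda_left_tensor)
  have powr: "(Lambda_right ^^ m) ?x = tensor f ((Lambda ^^ m) g)" for m
    using funpow_intertwine[where L = "tensor f" and D = Lambda and E = Lambda_right and m = m and v = g]
    by (simp add: Lambda_right_tensor)
  have nil_left: "nilpotent_at Lambda_left ?x"
    using nilpotent_at_Lambda[of f] plinear_zero[OF plinear_tensor_left[of g]]
    by (auto simp: nilpotent_at_def powl) metis
  have nil_right: "nilpotent_at Lambda_right ?x"
    using nilpotent_at_Lambda[of g] plinear_zero[OF plinear_tensor_right[of f]]
    by (auto simp: nilpotent_at_def powr) metis
  have nilK: "nilpotent_at ?K ?x"
    by (intro exp_op_sum(1) lin nil_left nil_right Lambda_left_right_commute)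
  have nilH: "nilpotent_at ?H ?x"
    by (intro exp_op_sum(1) linK linear_Omega nilK nilpotent_at_Omega KO)
  \<comment> \<open>A power of \<open>H\<close> that kills \<open>f \<otimes> g\<close> also kills its image under \<open>e\<^bsup>-t\<Omega>\<^esup>\<close>, as \<open>H\<close> and \<open>\<Omega>\<close>
     commute; this is what makes \<open>e\<^bsup>tH\<^esup>\<close> a finite sum there.\<close>
  have "nilpotent_at ?H ?w"
  proof -
    obtain N where N: "(?H ^^ N) ?x = 0" using nilH by (auto simp: nilpotent_at_def)
    have "(?H ^^ N) ?w = exp_op (- t) Omega ((?H ^^ N) ?x)"
      by (intro exp_op_intertwine plinear_funpow linH linear_Omega nilpotent_at_Omega
          funpow_intertwine[symmetric] HO[symmetric])
    also have "\<dots> = 0"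
      unfolding N by (intro exp_op_zero_vector linear_Omega plinear_zero)
    finally show ?thesis by (auto simp: nilpotent_at_def)
  qed
  then have "Phi t (star t f g) = mu (exp_op t ?H ?w)"
    unfolding Phi_def star_def
    by (intro exp_op_intertwine[symmetric] plinear_mu linH linear_Lambda Lambda_mu[symmetric])
  also have "exp_op t ?H ?w = exp_op 1 (\<lambda>u. pscale t (?H u) + pscale (- t) (Omega u)) ?x"
    by (intro exp_op_commuting linH linear_Omega HO nilH nilpotent_at_Omega)
  also have "(\<lambda>u. pscale t (?H u) + pscale (- t) (Omega u))
      = (\<lambda>u. pscale t (Lambda_left u) + pscale t (Lambda_right u))"
    by (simp add: pvs.scale_right_distrib)
  also have "exp_op 1 \<dots> ?x = exp_op t Lambda_left (exp_op t Lambda_right ?x)"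
    by (intro exp_op_commuting[symmetric] lin Lambda_left_right_commute nil_left nil_right)
  also have "exp_op t Lambda_right ?x = tensor f (Phi t g)"
    unfolding Phi_def
    by (intro exp_op_intertwine[symmetric] plinear_tensor_right linear_Lambda plinear_Lambda_right
        nilpotent_at_Lambda Lambda_right_tensor[symmetric])
  also have "exp_op t Lambda_left (tensor f (Phi t g)) = tensor (Phi t f) (Phi t g)"
    unfolding Phi_def
    by (rule exp_op_intertwine[OF plinear_tensor_left linear_Lambda plinear_Lambda_left
          Lambda_left_tensor[symmetric] nilpotent_at_Lambda, symmetric])
  finally show ?thesis by (simp add: mu_tensor)
qed

lemma plinear_Phi: "plinear (Phi t)"
  unfolding Phi_def by (intro plinear_exp_op linear_Lambda nilpotent_at_Lambda)

lemma Phi_add: "Phi s (Phi t f) = Phi (s + t) f"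
  unfolding Phi_def
  by (subst exp_op_commuting)
     (simp_all add: linear_Lambda nilpotent_at_Lambda exp_op_scaled[OF linear_Lambda, of "s + t"]
        pvs.scale_left_distrib)

lemma Phi_zero: "Phi 0 f = f"
  by (simp add: Phi_def exp_op_0)

lemma Phi_inverse: "Phi t (Phi (- t) f) = f" "Phi (- t) (Phi t f) = f"
  by (simp_all add: Phi_add Phi_zero)

lemma Phi_fixed: "Lambda f = 0 \<Longrightarrow> Phi t f = f"
  unfolding Phi_def by (rule exp_op_zero_vector[OF linear_Lambda])

lemma Lambda_one: "Lambda 1 = 0"
  by (simp add: Lambda_def pderivative_single single_one[symmetric] del: single_one)

lemma algebra_iso_Phi: "algebra_iso (star t) (*) (Phi t)"
proof -
  have "bij (Phi t)"
    by (rule o_bij[of "Phi (- t)"]) (auto simp: Phi_inverse)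
  moreover have "Phi t 1 = 1" by (rule Phi_fixed[OF Lambda_one])
  ultimately show ?thesis
    by (simp add: algebra_iso_def plinear_Phi Phi_star)
qed

section \<open>Monomials and constant terms\<close>

lemma pvar_power: "pvar v ^ m = Poly_Mapping.single (Poly_Mapping.single v m) 1"
  by (induction m) (simp_all add: pvar_def mult_single single_add[symmetric])

lemma prod_monomials:
  "(\<Prod>i\<in>S. Poly_Mapping.single (k i) 1) = (Poly_Mapping.single (\<Sum>i\<in>S. k i) 1 :: 'n xzpoly)"
  by (induction S rule: infinite_finite_induct) (simp_all add: mult_single)

lemma xi_pow_monomial:
    "xi_pow \<alpha> = Poly_Mapping.single (\<Sum>i\<in>UNIV. Poly_Mapping.single (Inl i) (\<alpha> i)) 1"
  and z_pow_monomial: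
    "z_pow \<beta> = Poly_Mapping.single (\<Sum>i\<in>UNIV. Poly_Mapping.single (Inr i) (\<beta> i)) 1"
  by (simp_all add: xi_pow_def z_pow_def pvar_power prod_monomials)

lemma Lambda_xi_pow: "Lambda (xi_pow \<alpha>) = 0"
  by (simp add: Lambda_def xi_pow_monomial pderivative_single lookup_sum lookup_single
      plinear_zero[OF linear_pderivative])

lemma Lambda_z_pow: "Lambda (z_pow \<beta>) = 0"
proof -
  have "d_xi i (z_pow \<beta>) = 0" for i
    by (simp add: z_pow_monomial pderivative_single lookup_sum lookup_single)
  then show ?thesis
    by (simp add: Lambda_def pderivative_commute[of "Inl i" "Inr i" for i])
qed

text \<open>
  Both factors are fixed by \<open>\<Phi>\<^sub>t\<close>, being killed by \<open>\<Lambda>\<close>, and \<open>\<Phi>\<^sub>t\<close> is multiplicative.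
\<close>

lemma Phi_star_xi_z: "Phi t (star t (xi_pow \<alpha>) (z_pow \<beta>)) = xi_pow \<alpha> * z_pow \<beta>"
  by (simp add: Phi_star Phi_fixed Lambda_xi_pow Lambda_z_pow)

lemma constant_term_xi_z:
  assumes "(\<Sum>i\<in>UNIV. \<alpha> i + \<beta> i) \<ge> 1"
  shows "Poly_Mapping.lookup (xi_pow \<alpha> * z_pow \<beta> :: 'n::finite xzpoly) 0 = 0"
proof -
  obtain i where "\<alpha> i \<noteq> 0 \<or> \<beta> i \<noteq> 0"
    using assms by (metis (no_types, lifting) add_is_0 not_one_le_zero sum.neutral)
  let ?a = "(\<Sum>i\<in>UNIV. Poly_Mapping.single (Inl i) (\<alpha> i))
      + (\<Sum>i\<in>UNIV. Poly_Mapping.single (Inr i) (\<beta> i)) :: 'n xzmon"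
  have "Poly_Mapping.lookup ?a (Inl i) = \<alpha> i" "Poly_Mapping.lookup ?a (Inr i) = \<beta> i"
    by (simp_all add: lookup_add lookup_sum lookup_single when_def)
  then have "?a \<noteq> 0" using \<open>\<alpha> i \<noteq> 0 \<or> \<beta> i \<noteq> 0\<close> by force
  then show ?thesis
    by (simp add: xi_pow_monomial z_pow_monomial mult_single lookup_single when_def)
qed

text \<open>
  The elements \<open>\<xi>\<^sub>i\<^sup>m z\<^sub>i\<^sup>m\<close> tell the topologies apart: they have arbitrarily high order, but \<open>\<Lambda>\<^sup>m\<close>
  maps them to nonzero constants.
\<close>

definition xi_z_power :: "'n::finite \<Rightarrow> nat \<Rightarrow> 'n xzpoly" where
  "xi_z_power i m = pvar (Inl i) ^ m * pvar (Inr i) ^ m"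

lemma xi_z_power_monomial: "xi_z_power i m
    = Poly_Mapping.single (Poly_Mapping.single (Inl i) m + Poly_Mapping.single (Inr i) m) 1"
  by (simp add: xi_z_power_def pvar_power mult_single)

lemma xi_z_power_eq: "xi_z_power i m
    = xi_pow (\<lambda>j. if j = i then m else 0) * z_pow (\<lambda>j. if j = i then m else 0)"
  by (simp add: xi_z_power_def xi_pow_def z_pow_def if_distrib[of "power x" for x] cong: if_cong)

lemma Lambda_xi_z_power_0: "Lambda (xi_z_power i 0) = 0"
  by (simp add: xi_z_power_def Lambda_one)

lemma Lambda_xi_z_power_Suc:
  "Lambda (xi_z_power i (Suc m)) = pscale (of_nat (Suc m) ^ 2) (xi_z_power i m)"
proof -
  have "d_xi j (d_z j (xi_z_power i (Suc m)))
      = (if j = i then pscale (of_nat (Suc m) ^ 2) (xi_z_power i m) else 0)" for j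
  proof (cases "j = i")
    case True
    have "Poly_Mapping.single (Inl i) (Suc m) + Poly_Mapping.single (Inr i) (Suc m)
        - Poly_Mapping.single (Inr i) 1 - Poly_Mapping.single (Inl i) 1
      = (Poly_Mapping.single (Inl i) m + Poly_Mapping.single (Inr i) m :: 'a xzmon)"
      by (rule poly_mapping_eqI) (auto simp: lookup_add lookup_minus lookup_single when_def)
    with True show ?thesis
      by (simp add: xi_z_power_monomial pderivative_single lookup_add lookup_minus lookup_single
          power2_eq_square del: of_nat_Suc)
  next
    case False
    then show ?thesis
      by (simp add: xi_z_power_monomial pderivative_single lookup_add lookup_minus lookup_single)
  qed
  then show ?thesis by (simp add: Lambda_def)
qed

text \<open>
  Each application of \<open>\<Lambda>\<close> lowers \<open>m\<close> by one at the cost of the factor \<open>m\<^sup>2\<close>, so a constant is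
  reached exactly at the \<open>m\<close>-th step.
\<close>

lemma constant_term_funpow_Lambda:
  "Poly_Mapping.lookup ((Lambda ^^ k) (xi_z_power i m)) 0 = (if k = m then fact m ^ 2 else 0)"
proof (induction k arbitrary: m)
  case 0
  show ?case
    by (auto simp: xi_z_power_monomial lookup_single when_def dest!: arg_cong[of _ _ "\<lambda>a. Poly_Mapping.lookup a (Inl i)"] simp: lookup_add)
next
  case (Suc k)
  show ?case
  proof (cases m)
    case 0
    then show ?thesis
      by (simp add: funpow_Suc_right Lambda_xi_z_power_0 plinear_zero[OF plinear_funpow[OF linear_Lambda]]
          del: funpow.simps)
  next
    case m: (Suc l)
    then show ?thesis
      by (simp add: funpow_Suc_right Lambda_xi_z_power_Suc Suc.IH power_mult_distrib
          plinear_scale[OF plinear_funpow[OF linear_Lambda]] del: funpow.simps of_nat_Suc)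
  qed
qed

lemma constant_term_Phi:
  "Poly_Mapping.lookup (Phi c (xi_z_power i m)) 0 = c ^ m * fact m"
proof -
  obtain N where N: "(Lambda ^^ N) (xi_z_power i m) = 0"
    using nilpotent_at_Lambda[of "xi_z_power i m"] by (auto simp: nilpotent_at_def)
  \<comment> \<open>The range of summation must include the only contributing index \<open>m\<close>.\<close>
  then have N: "(Lambda ^^ (max N (Suc m))) (xi_z_power i m) = 0"
    by (rule funpow_zero_mono[OF linear_Lambda]) simp
  have "Poly_Mapping.lookup (Phi c (xi_z_power i m)) 0
     = (\<Sum>k<max N (Suc m). c ^ k / fact k * (if k = m then fact m ^ 2 else 0))"
    unfolding Phi_def exp_op_finite_sum[OF linear_Lambda N]
    by (simp add: lookup_sum constant_term_funpow_Lambda)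
  also have "\<dots> = (\<Sum>k<max N (Suc m). if k = m then c ^ m / fact m * fact m ^ 2 else 0)"
    by (intro sum.cong refl) simp
  finally have "Poly_Mapping.lookup (Phi c (xi_z_power i m)) 0 = c ^ m / fact m * fact m ^ 2"
    by simp
  then show ?thesis by (simp add: power2_eq_square)
qed

section \<open>The topologies\<close>

text \<open>
  \<open>\<Phi>\<^sub>t\<close> matches the spanning vectors of the two subspaces one by one.
\<close>

lemma Phi_image_U_space: "Phi t ` U_space t m = U_space 0 m"
proof -
  have *: "{star r (xi_pow \<alpha>) (z_pow \<beta>) |\<alpha> \<beta>. (\<Sum>i\<in>UNIV. \<alpha> i + \<beta> i) \<ge> m}
      = (\<lambda>(\<alpha>, \<beta>). star r (xi_pow \<alpha>) (z_pow \<beta>)) ` {(\<alpha>, \<beta>). (\<Sum>i\<in>UNIV. \<alpha> i + \<beta> i) \<ge> m}"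
    for r :: complex
    by (auto simp: image_def)
  have hom: "module_hom pscale pscale (Phi t)"
    using plinear_Phi by (simp only: Vector_Spaces.linear_iff_module_hom)
  show ?thesis
    unfolding U_space_def * module_hom.span_image[OF hom, symmetric] image_image
    by (simp add: case_prod_unfold Phi_star_xi_z star_0)
qed

lemma Phi_image_U_space_0: "Phi (- t) ` U_space 0 m = U_space t m"
  by (simp add: Phi_image_U_space[of t, symmetric] image_image Phi_inverse)

lemma openin_translate_U_space: "openin (ell_topology t) ((+) f ` U_space t m)"
  unfolding ell_topology_def by (rule topology_generated_by_Basis) blast

text \<open>
  The preimage of a generating open set \<open>f + U\<close> under \<open>\<phi>\<close> is its image under the linear inverse
  \<open>\<psi>\<close>, namely the translate of \<open>\<psi> U\<close> by \<open>\<psi> f\<close>.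
\<close>

lemma continuous_map_ell_topology:
  fixes \<phi> \<psi> :: "'n::finite xzpoly \<Rightarrow> 'n xzpoly"
  assumes "plinear \<psi>" "\<And>f. \<psi> (\<phi> f) = f" "\<And>f. \<phi> (\<psi> f) = f"
    and U: "\<And>m. \<psi> ` U_space t m = U_space s m"
  shows "continuous_map (ell_topology s) (ell_topology t) \<phi>"
proof -
  have "\<phi> -` (+) f ` U_space t m = (+) (\<psi> f) ` U_space s m" for f m
  proof -
    have "\<phi> -` (+) f ` U_space t m = \<psi> ` (+) f ` U_space t m"
    proof (intro set_eqI iffI)
      fix x assume "x \<in> \<phi> -` (+) f ` U_space t m"
      then show "x \<in> \<psi> ` (+) f ` U_space t m"
        using assms(2)[of x] by (metis image_eqI vimageD)
    qed (auto simp: assms(3))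
    also have "\<dots> = (+) (\<psi> f) ` \<psi> ` U_space t m"
      by (simp add: image_image plinear_add[OF assms(1)])
    finally show ?thesis by (simp add: U)
  qed
  moreover have "\<exists>V. (\<exists>f m. V = (+) f ` U_space t m) \<and> g \<in> V" for g :: "'n xzpoly"
  proof -
    have "topspace (ell_topology t :: 'n xzpoly topology) = UNIV"
      by (rule topspace_ell_topology)
    then have "g \<in> \<Union> {(+) f ` U_space t m | f m. True}"
      unfolding ell_topology_def topology_generated_by_topspace by blast
    then show ?thesis by blast
  qed
  ultimately show ?thesis
    unfolding ell_topology_def[of t]
    by (subst continuous_on_generated_topo_iff)
       (auto simp: topspace_ell_topology openin_translate_U_space)
qed

lemma homeomorphic_maps_Phi: "homeomorphic_maps (ell_topology t) (ell_topology 0) (Phi t) (Phi (- t))"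
  unfolding homeomorphic_maps_def
  by (auto intro!: Phi_inverse
      continuous_map_ell_topology[OF plinear_Phi Phi_inverse(2,1) Phi_image_U_space_0]
      continuous_map_ell_topology[OF plinear_Phi Phi_inverse Phi_image_U_space])

lemma U_space_antimono: "k \<le> m \<Longrightarrow> U_space t m \<subseteq> U_space t k"
  unfolding U_space_def by (rule pvs.span_mono) (use order_trans in blast)

text \<open>
  The generating sets are only a subbase by definition. That the translates of the subspaces by
  \<open>x\<close> form a neighbourhood base at \<open>x\<close> rests on two facts: a coset of a subspace is the translate
  by any of its points, and the subspaces decrease with \<open>m\<close>, which handles intersections.
\<close>

lemma ell_topology_neighbourhood:
  fixes W :: "'n::finite xzpoly set"
  assumes "openin (ell_topology t) W" "x \<in> W"
  shows "\<exists>m. (+) x ` U_space t m \<subseteq> W"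
proof -
  have "generate_topology_on {(+) f ` U_space t m | f m. True} W"
    using assms(1) by (simp add: ell_topology_def openin_topology_generated_by_iff)
  then show ?thesis using assms(2)
  proof (induction arbitrary: x)
    case (Int V W)
    then obtain k m where "(+) x ` U_space t k \<subseteq> V" "(+) x ` U_space t m \<subseteq> W"
      by (metis IntE)
    then have "(+) x ` U_space t (max k m) \<subseteq> V \<inter> W"
      using U_space_antimono[of k "max k m" t] U_space_antimono[of m "max k m" t] by fastforce
    then show ?case by blast
  next
    case (UN K)
    then obtain V where V: "V \<in> K" "x \<in> V" by blast
    then obtain m where "(+) x ` U_space t m \<subseteq> V" using UN.IH by blast
    then show ?case using V(1) by blast
  next
    case (Basis V)
    then obtain f m u where V: "V = (+) f ` U_space t m" and u: "x = f + u" "u \<in> U_space t m"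
      by blast
    have "(+) x ` U_space t m \<subseteq> V"
    proof (rule image_subsetI)
      fix w :: "'n xzpoly" assume "w \<in> U_space t m"
      then have "u + w \<in> U_space t m"
        using u(2) unfolding U_space_def by (intro pvs.span_add)
      then show "x + w \<in> V" by (simp add: V u(1) add.assoc)
    qed
    then show ?case by blast
  qed auto
qed

lemma constant_term_U_space_0:
  assumes "f \<in> U_space 0 1"
  shows "Poly_Mapping.lookup f 0 = 0"
  using assms unfolding U_space_def
  by (induction rule: pvs.span_induct_alt)
     (auto simp: lookup_add star_0 constant_term_xi_z)

text \<open>
  An inclusion of the subspace of index \<open>(t, m)\<close> in that of index \<open>(s, 1)\<close> is contradicted, for
  \<open>s \<noteq> t\<close>, by \<open>\<Phi>\<^bsub>-t\<^esub> (\<xi>\<^sub>i\<^sup>m z\<^sub>i\<^sup>m)\<close>: it lies in the former, but \<open>\<Phi>\<^sub>s\<close> maps it to a polynomial with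
  constant term \<open>(s - t)\<^sup>m m! \<noteq> 0\<close>.
\<close>

lemma ell_topology_inj:
  assumes "ell_topology s = (ell_topology t :: 'n::finite xzpoly topology)"
  shows "s = t"
proof -
  fix i :: 'n
  have "openin (ell_topology t) (U_space s 1 :: 'n xzpoly set)"
    using openin_translate_U_space[of s "0 :: 'n xzpoly" 1] assms by simp
  moreover have "0 \<in> U_space s 1" by (simp add: U_space_def pvs.span_zero)
  ultimately obtain m where m: "U_space t m \<subseteq> (U_space s 1 :: 'n xzpoly set)"
    using ell_topology_neighbourhood[of t "U_space s 1" 0] by auto
  have "(\<Sum>j\<in>UNIV. (if j = i then m else 0) + (if j = i then m else 0)) \<ge> m"
    by (simp add: sum.distrib)
  then have "xi_z_power i m \<in> U_space 0 m"
    unfolding U_space_def star_0 xi_z_power_eq by (intro pvs.span_base) blast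
  then have "Phi (- t) (xi_z_power i m) \<in> U_space s 1"
    using m Phi_image_U_space_0[of t m] by blast
  then have "Phi s (Phi (- t) (xi_z_power i m)) \<in> U_space 0 1"
    using Phi_image_U_space[of s 1] by blast
  then have "(s - t) ^ m * fact m = 0"
    using constant_term_U_space_0[of "Phi s (Phi (- t) (xi_z_power i m))"]
    by (simp add: Phi_add constant_term_Phi)
  then show "s = t" by simp
qed

theorem proposition2p9:
  shows "(\<forall>s t. s \<noteq> t \<longrightarrow> (ell_topology s :: 'n::finite xzpoly topology) \<noteq> ell_topology t) \<and>
    (\<forall>t. algebra_iso (star t) (*) (Phi t :: 'n xzpoly \<Rightarrow> 'n xzpoly) \<and>
         homeomorphic_map (ell_topology t) (ell_topology 0) (Phi t :: 'n xzpoly \<Rightarrow> 'n xzpoly)) \<and>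
    (\<forall>s t. (ell_topology s :: 'n xzpoly topology) homeomorphic_space
           (ell_topology t :: 'n xzpoly topology))"
proof (intro conjI allI impI)
  fix s t :: complex
  show "s \<noteq> t \<Longrightarrow> (ell_topology s :: 'n xzpoly topology) \<noteq> ell_topology t"
    using ell_topology_inj by blast
  show "algebra_iso (star t) (*) (Phi t :: 'n xzpoly \<Rightarrow> 'n xzpoly)"
    by (rule algebra_iso_Phi)
  show "homeomorphic_map (ell_topology t) (ell_topology 0) (Phi t :: 'n xzpoly \<Rightarrow> 'n xzpoly)"
    unfolding homeomorphic_map_maps by (intro exI) (rule homeomorphic_maps_Phi)
  have to_0: "(ell_topology r :: 'n xzpoly topology) homeomorphic_space
      (ell_topology 0 :: 'n xzpoly topology)" for r
    unfolding homeomorphic_space_def by (intro exI) (rule homeomorphic_maps_Phi)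
  show "(ell_topology s :: 'n xzpoly topology) homeomorphic_space
      (ell_topology t :: 'n xzpoly topology)"
    using to_0[of s] homeomorphic_space_sym[THEN iffD1, OF to_0[of t]]
    by (rule homeomorphic_space_trans)
qed

end
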